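(* There is an absolute constant $K$ such that the following holds. For each binary linear code $\mathcal{C}$ of length $n\ge 1$ there exist a triangular configuration $\Delta$ and a positive integer $e$ that is linear in $n$ (i.e. $e\le Kn$) such that, if the weight enumerator of the cycle space of $\Delta$ equals $$\sum_{i=0}^{m}a_ix^i,$$ then the weight enumerator of $\mathcal{C}$ satisfies $$W_{\mathcal{C}}(x^2)=\sum_{i=0}^{m}a_ix^{i\bmod e}.$$
   Context: A binary linear code of length $n$ is a linear subspace $\mathcal{C}$ of $GF(2)^n$; its elements are codewords. The weight $w(c)$ of a codeword is its number of nonzero coordinates, and the weight enumerator is $W_{\mathcal{C}}(x)=\sum_{c\in\mathcal{C}}x^{w(c)}$. A triangular configuration is a finite simplicial complex of dimension $2$ in which every maximal simplex is a triangle (the empty complex is allowed). The cycle space of a triangular configuration $\Delta$ is the kernel over $GF(2)$ of its incidence matrix, whose rows are indexed by the edges of $\Delta$, whose columns are indexed by the triangles of $\Delta$, and whose entry is $1$ if the edge belongs to the triangle and $0$ otherwise. It is a binary linear code whose length is the number of triangles of $\Delta$. Here $i\bmod e$ denotes the remainder in $\{0,\dots,e-1\}$. *)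

theory Defs
  imports
    "HOL-Library.Z2"
    "HOL-Library.Function_Algebras"
    "HOL-Computational_Algebra.Polynomial"
begin

text \<open>
  The field GF(2) is the type \<^typ>\<open>bit\<close>. A vector with coordinates indexed by a finite
  set \<open>E\<close> is a function that vanishes outside \<open>E\<close>; the index set is a set rather
  than a type because the length of a code has to be quantified below a constant that does not
  depend on it. So \<open>GF(2)^n\<close> is \<open>words {..<n}\<close>.
\<close>

definition words :: "'a set \<Rightarrow> ('a \<Rightarrow> bit) set" where
  "words E = {c. \<forall>x. x \<notin> E \<longrightarrow> c x = 0}"

global_interpretation bitvec: vector_space "\<lambda>(a::bit) (c::'a \<Rightarrow> bit) x. a * c x"
  by unfold_locales (auto simp: fun_eq_iff algebra_simps)

definition linear_code :: "'a set \<Rightarrow> ('a \<Rightarrow> bit) set \<Rightarrow> bool" where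
  "linear_code E C \<longleftrightarrow> C \<subseteq> words E \<and> bitvec.subspace C"

definition weight :: "('a \<Rightarrow> bit) \<Rightarrow> nat" where
  "weight c = card {x. c x \<noteq> 0}"

definition weight_enumerator :: "('a \<Rightarrow> bit) set \<Rightarrow> int poly" where
  "weight_enumerator C = (\<Sum>c\<in>C. monom 1 (weight c))"

text \<open>
  Simplicial complexes are abstract: a simplex is identified with its nonempty finite set of
  vertices. A nonempty complex all of whose maximal simplices are triangles has dimension 2, so
  the dimension needs no separate clause; the empty complex is \<open>{}\<close>.
\<close>

definition simplicial_complex :: "'v set set \<Rightarrow> bool" where
  "simplicial_complex \<Delta> \<longleftrightarrow>
     (\<forall>\<sigma>\<in>\<Delta>. finite \<sigma> \<and> \<sigma> \<noteq> {}) \<and> (\<forall>\<sigma>\<in>\<Delta>. \<forall>\<tau>. \<tau> \<subseteq> \<sigma> \<and> \<tau> \<noteq> {} \<longrightarrow> \<tau> \<in> \<Delta>)"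

definition triangular_configuration :: "'v set set \<Rightarrow> bool" where
  "triangular_configuration \<Delta> \<longleftrightarrow>
     finite \<Delta> \<and> simplicial_complex \<Delta> \<and>
     (\<forall>\<sigma>\<in>\<Delta>. (\<forall>\<tau>\<in>\<Delta>. \<sigma> \<subseteq> \<tau> \<longrightarrow> \<tau> = \<sigma>) \<longrightarrow> card \<sigma> = 3)"

definition triangles :: "'v set set \<Rightarrow> 'v set set" where
  "triangles \<Delta> = {\<sigma>\<in>\<Delta>. card \<sigma> = 3}"

definition edges :: "'v set set \<Rightarrow> 'v set set" where
  "edges \<Delta> = {\<sigma>\<in>\<Delta>. card \<sigma> = 2}"

definition incidence :: "'v set \<Rightarrow> 'v set \<Rightarrow> bit" where
  "incidence \<epsilon> t = (if \<epsilon> \<subseteq> t then 1 else 0)"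

definition cycle_space :: "'v set set \<Rightarrow> ('v set \<Rightarrow> bit) set" where
  "cycle_space \<Delta> =
     {c \<in> words (triangles \<Delta>). \<forall>\<epsilon>\<in>edges \<Delta>. (\<Sum>t\<in>triangles \<Delta>. incidence \<epsilon> t * c t) = 0}"

lemma finite_words:
  assumes "finite E"
  shows "finite (words E)"
proof -
  have "words E \<subseteq> {c. \<forall>x. (x \<in> E \<longrightarrow> c x \<in> UNIV) \<and> (x \<notin> E \<longrightarrow> c x = 0)}"
    by (auto simp: words_def)
  moreover have "finite (UNIV :: bit set)"
    by (rule finite_subset[of _ "{0, 1}"]) (auto simp: bit_not_zero_iff)
  ultimately show ?thesis
    using finite_set_of_finite_funs[OF assms, of "UNIV :: bit set" 0] finite_subset by blast
qed

lemma linear_code_cycle_space: "linear_code (triangles \<Delta>) (cycle_space \<Delta>)"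
proof -
  have add: "(\<Sum>t\<in>T. f t * (c t + d t)) = (\<Sum>t\<in>T. f t * c t) + (\<Sum>t\<in>T. f t * d t)"
    for f c d :: "'b \<Rightarrow> bit" and T
    by (simp only: distrib_left sum.distrib)
  have scale: "(\<Sum>t\<in>T. f t * (a * c t)) = a * (\<Sum>t\<in>T. f t * c t)"
    for f c :: "'b \<Rightarrow> bit" and a T
    by (simp only: mult.left_commute[of _ a] sum_distrib_left)
  show ?thesis
    unfolding linear_code_def bitvec.subspace_def cycle_space_def words_def
    by (simp only: mem_Collect_eq plus_fun_apply zero_fun_apply add scale) auto
qed

end

theory Submission imports Defs begin

text \<open>
  A triangular configuration amounts to a finite set \<open>H\<close> of triples, its triangles, and its cycle
  space consists of the vectors on \<open>H\<close> whose values around every pair of vertices sum to \<open>0\<close>. It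
  therefore suffices to find, for a code \<open>C\<close> of length \<open>n\<close>, such an \<open>H\<close> with \<open>n\<close> marked triangles
  on which the cycles of \<open>H\<close> are read off as exactly the words of \<open>C\<close>, each word once, and then
  to control the weights.

  The weights can be prescribed almost freely: replacing a triangle by the cone over its boundary
  from a new vertex replaces one coordinate by three copies of it and does not otherwise change
  the cycle space, so each coordinate can be repeated any odd number of times
  (\<open>weight_enumerator_of_odd_loads\<close>). Take \<open>e = 2 * n + 1\<close>, repeat the marked triangles \<open>e + 2\<close>
  times and all others \<open>e\<close> times. As \<open>e\<close> is odd, both numbers are odd, and the cycle that belongs
  to the word \<open>c\<close> has weight congruent to \<open>2 * weight c\<close> modulo \<open>e\<close>. Since
  \<open>2 * weight c \<le> 2 * n < e\<close>, reducing the exponents modulo \<open>e\<close> recovers \<open>2 * weight c\<close>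
  (\<open>load_mod\<close>).

  The marked triangles are built one generator of \<open>C\<close> at a time (\<open>realizable_span\<close>), starting
  from disjoint triangles, where all values are \<open>0\<close>. To add a word \<open>b\<close>, add a disjoint tetrahedron
  boundary. It contributes one free value \<open>\<alpha>\<close>, read off on one of its triangles. Then add \<open>\<alpha>\<close> to the
  value of the marked triangle \<open>j\<close>, for each \<open>j\<close> in the support of \<open>b\<close>, and forget the auxiliary
  triangle; nothing is lost as long as \<open>b\<close> was not already in the code (\<open>realizable_add_word\<close>).

  The geometric core is the row operation that adds the value of a marked triangle \<open>k\<close> to that of
  another one \<open>j\<close> (\<open>realizes_row_operation\<close>). Topologically, the interior of \<open>k\<close> is cut out and a
  tube is glued in that runs from its boundary to the boundary of \<open>j\<close>; around an edge of \<open>j\<close> the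
  tube adds its own value, which is that of \<open>k\<close>. The tube is made of cones: replacing a triangle
  \<open>{a, b, c}\<close> by the cone over its boundary from a vertex \<open>p\<close> moves the marked triangle, for
  instance, to \<open>{p, a, b}\<close>. A few moves with new apices take it away from \<open>j\<close>, so that the edges
  needed later are free, and three moves with the vertices of \<open>j\<close> as apices end on \<open>j\<close> itself.
\<close>

section \<open>Cycle spaces of triple systems\<close>

text \<open>
  Bits are elements of a field here, not truth values: rewriting their sums and products to
  bitwise operations would block the field laws.
\<close>

declare add_bit_eq_xor [simp del] mult_bit_eq_and [simp del]

lemma bit_add_self [simp]: "a + a = 0" "a + (a + b) = b" for a b :: bit
  by (cases a; cases b; simp)+

definition triple_system :: "'v set set \<Rightarrow> bool" where
  "triple_system H \<longleftrightarrow> finite H \<and> (\<forall>t\<in>H. card t = 3)"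

definition cycles :: "'v set set \<Rightarrow> ('v set \<Rightarrow> bit) set" where
  "cycles H = {c \<in> words H. \<forall>\<epsilon>. card \<epsilon> = 2 \<longrightarrow> (\<Sum>t\<in>H. incidence \<epsilon> t * c t) = 0}"

definition complex_of :: "'v set set \<Rightarrow> 'v set set" where
  "complex_of H = {\<sigma>. \<sigma> \<noteq> {} \<and> (\<exists>t\<in>H. \<sigma> \<subseteq> t)}"

lemma triple_system_finite: "triple_system H \<Longrightarrow> finite H"
  by (simp add: triple_system_def)

lemma triple_system_finite_triple: "triple_system H \<Longrightarrow> t \<in> H \<Longrightarrow> finite t"
  by (metis triple_system_def card.infinite zero_neq_numeral)

lemma finite_vertices: "triple_system H \<Longrightarrow> finite (\<Union>H)"
  using triple_system_finite triple_system_finite_triple by blast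

lemma triangular_configuration_complex_of:
  assumes "triple_system H"
  shows "triangular_configuration (complex_of H)"
proof -
  have "complex_of H \<subseteq> (\<Union>t\<in>H. Pow t)"
    by (auto simp: complex_of_def)
  then have "finite (complex_of H)"
    by (rule finite_subset)
      (use triple_system_finite[OF assms] triple_system_finite_triple[OF assms] in simp)
  moreover have "simplicial_complex (complex_of H)"
    using triple_system_finite_triple[OF assms]
    unfolding simplicial_complex_def complex_of_def by (blast intro: finite_subset)
  moreover have "card \<sigma> = 3"
    if \<sigma>: "\<sigma> \<in> complex_of H" and max: "\<forall>\<tau>\<in>complex_of H. \<sigma> \<subseteq> \<tau> \<longrightarrow> \<tau> = \<sigma>" for \<sigma>
  proof -
    obtain t where t: "t \<in> H" "\<sigma> \<subseteq> t" "\<sigma> \<noteq> {}"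
      using \<sigma> unfolding complex_of_def by blast
    then have "t \<in> complex_of H"
      by (auto simp: complex_of_def)
    with max t have "t = \<sigma>" by blast
    with t assms show ?thesis
      by (simp add: triple_system_def)
  qed
  ultimately show ?thesis
    by (auto simp: triangular_configuration_def)
qed

lemma triangles_complex_of:
  assumes "triple_system H"
  shows "triangles (complex_of H) = H"
proof -
  have "\<sigma> \<in> H" if "\<sigma> \<subseteq> t" "t \<in> H" "card \<sigma> = 3" for \<sigma> t
    using that assms triple_system_finite_triple[OF assms]
    by (metis card_subset_eq triple_system_def)
  then show ?thesis
    using assms by (force simp: triangles_def complex_of_def triple_system_def)
qed

lemma cycle_space_complex_of:
  assumes "triple_system H"
  shows "cycle_space (complex_of H) = cycles H"
proof -
  have "(\<Sum>t\<in>H. incidence \<epsilon> t * c t) = 0"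
    if "card \<epsilon> = 2" "\<epsilon> \<notin> edges (complex_of H)" for \<epsilon> and c :: "'a set \<Rightarrow> bit"
  proof (rule sum.neutral, rule ballI)
    fix t assume "t \<in> H"
    with that have "\<not> \<epsilon> \<subseteq> t"
      by (auto simp: edges_def complex_of_def)
    then show "incidence \<epsilon> t * c t = 0"
      by (simp add: incidence_def)
  qed
  then show ?thesis
    unfolding cycle_space_def cycles_def triangles_complex_of[OF assms]
    by (auto simp: edges_def)
qed

text \<open>
  Chains from different triple systems are compared and added inside a common larger one; this
  works because triangles on which a chain vanishes do not matter.
\<close>
lemma cycles_superset_iff:
  assumes "finite G" "H \<subseteq> G" "c \<in> words H"
  shows "c \<in> cycles G \<longleftrightarrow> c \<in> cycles H"
proof -
  have "(\<Sum>t\<in>G. incidence \<epsilon> t * c t) = (\<Sum>t\<in>H. incidence \<epsilon> t * c t)" for \<epsilon>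
    using assms by (intro sum.mono_neutral_right) (auto simp: words_def)
  moreover have "c \<in> words G"
    using assms by (auto simp: words_def)
  ultimately show ?thesis
    using assms by (simp add: cycles_def)
qed

lemma cycles_add_scaled:
  assumes "c \<in> cycles H" "d \<in> cycles H"
  shows "(\<lambda>s. c s + \<alpha> * d s) \<in> cycles H"
proof -
  have "(\<Sum>t\<in>H. incidence \<epsilon> t * (c t + \<alpha> * d t)) =
      (\<Sum>t\<in>H. incidence \<epsilon> t * c t) + \<alpha> * (\<Sum>t\<in>H. incidence \<epsilon> t * d t)" for \<epsilon>
    by (simp only: distrib_left sum.distrib sum_distrib_left mult.left_commute[of _ \<alpha>])
  then show ?thesis
    using assms by (simp add: cycles_def words_def)
qed

text \<open>
  The two values sum to \<open>0\<close> around the edge, and in characteristic 2 this makes them equal. This is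
  how the constructions below force a value to propagate.
\<close>
lemma cycles_shared_edge:
  assumes "c \<in> cycles H" "finite H" "card \<epsilon> = 2"
    and "{t \<in> H. \<epsilon> \<subseteq> t} = {s, s'}" "s \<noteq> s'"
  shows "c s = c s'"
proof -
  have "0 = (\<Sum>t\<in>H. incidence \<epsilon> t * c t)"
    using assms(1,3) by (simp add: cycles_def)
  also have "\<dots> = (\<Sum>t\<in>{t \<in> H. \<epsilon> \<subseteq> t}. c t)"
    unfolding sum.inter_filter[OF assms(2)] by (intro sum.cong) (auto simp: incidence_def)
  also have "\<dots> = c s + c s'"
    using assms(4,5) by simp
  finally show ?thesis
    by (cases "c s"; cases "c s'") auto
qed

lemma cycles_remove_triangle:
  assumes "finite G"
  shows "cycles (G - {t}) = {c \<in> cycles G. c t = 0}"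
proof -
  have "c \<in> words (G - {t}) \<longleftrightarrow> c \<in> words G \<and> c t = 0" for c
    by (auto simp: words_def)
  moreover have "c \<in> words H" if "c \<in> cycles H" for c and H :: "'a set set"
    using that by (simp add: cycles_def)
  ultimately show ?thesis
    using cycles_superset_iff[OF assms, of "G - {t}"] by blast
qed

section \<open>Replacing a triangle by a cone\<close>

definition cone :: "'v \<Rightarrow> 'v \<Rightarrow> 'v \<Rightarrow> 'v \<Rightarrow> 'v set set" where
  "cone p a b c = {{p, a, b}, {p, a, c}, {p, b, c}}"

text \<open>
  The sum of a triangle and of the cone over its boundary is the boundary of a tetrahedron, hence
  a cycle. Adding a multiple of it moves the value of a cycle from the triangle to the cone.
\<close>
definition tetrahedron :: "'v \<Rightarrow> 'v \<Rightarrow> 'v \<Rightarrow> 'v \<Rightarrow> 'v set \<Rightarrow> bit" where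
  "tetrahedron p a b c s = of_bool (s \<in> insert {a, b, c} (cone p a b c))"

definition adjacent :: "'v set set \<Rightarrow> 'v \<Rightarrow> 'v \<Rightarrow> bool" where
  "adjacent H u v \<longleftrightarrow> (\<exists>t\<in>H. u \<in> t \<and> v \<in> t)"

lemma tetrahedron_cycle:
  assumes "distinct [p, a, b, c]"
  shows "tetrahedron p a b c \<in> cycles (insert {a, b, c} (cone p a b c))"
proof -
  let ?T = "insert {a, b, c} (cone p a b c)"
  have neq: "{a, b, c} \<noteq> {p, a, b}" "{a, b, c} \<noteq> {p, a, c}" "{a, b, c} \<noteq> {p, b, c}"
    "{p, a, b} \<noteq> {p, a, c}" "{p, a, b} \<noteq> {p, b, c}" "{p, a, c} \<noteq> {p, b, c}"
    using assms by auto
  have "(\<Sum>t\<in>?T. incidence \<epsilon> t * tetrahedron p a b c t) = 0" if "card \<epsilon> = 2" for \<epsilon>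
  proof -
    obtain u v where uv: "\<epsilon> = {u, v}" "u \<noteq> v"
      using \<open>card \<epsilon> = 2\<close> by (auto simp: card_2_iff)
    have "(\<Sum>t\<in>?T. incidence \<epsilon> t * tetrahedron p a b c t) = (\<Sum>t\<in>?T. incidence \<epsilon> t)"
      by (intro sum.cong) (auto simp: tetrahedron_def)
    also have "\<dots> = incidence \<epsilon> {a, b, c} + incidence \<epsilon> {p, a, b} + incidence \<epsilon> {p, a, c}
        + incidence \<epsilon> {p, b, c}"
      using neq by (simp add: cone_def add.assoc)
    also have "\<dots> = 0"
      using assms uv by (auto simp: incidence_def)
    finally show ?thesis .
  qed
  then show ?thesis
    by (simp add: cycles_def words_def tetrahedron_def)
qed

text \<open>
  The pair \<open>{p, a}\<close> lies only in two triangles of the cone, so their values agree. The third one,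
  \<open>{p, b, c}\<close>, is tied to them by the pair \<open>{p, b}\<close> in the same way, unless it was already there;
  then it is not a new triangle. The second alternative is what lets a tube end on a given
  triangle.
\<close>
lemma cone_constant:
  assumes "finite H" "distinct [p, a, b, c]" "\<not> adjacent H p a"
    and "\<not> adjacent H p b \<or> {p, b, c} \<in> H"
    and "d \<in> cycles (H \<union> cone p a b c)" "s \<in> cone p a b c - H"
  shows "d s = d {p, a, b}"
proof -
  have fin: "finite (H \<union> cone p a b c)"
    using assms(1) by (simp add: cone_def)
  have "{t \<in> H \<union> cone p a b c. {p, a} \<subseteq> t} = {{p, a, b}, {p, a, c}}"
    using assms(2,3) by (auto simp: cone_def adjacent_def)
  then have ac: "d {p, a, b} = d {p, a, c}"
    by (rule cycles_shared_edge[OF assms(5) fin, rotated]) (use assms(2) in auto)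
  show ?thesis
  proof (cases "{p, b, c} \<in> H")
    case False
    with assms(4) have "{t \<in> H \<union> cone p a b c. {p, b} \<subseteq> t} = {{p, a, b}, {p, b, c}}"
      using assms(2) by (auto simp: cone_def adjacent_def)
    then have "d {p, a, b} = d {p, b, c}"
      by (rule cycles_shared_edge[OF assms(5) fin, rotated]) (use assms(2) in auto)
    with ac show ?thesis
      using assms(6) by (auto simp: cone_def)
  qed (use ac assms(6) in \<open>auto simp: cone_def\<close>)
qed

text \<open>
  Since a cycle is constant on the new triangles of the cone, a multiple of the tetrahedron
  cancels it there and leaves a cycle of the old system. So the cone adds one dimension.
\<close>
lemma cycles_attach_cone:
  assumes "finite H" "{a, b, c} \<in> H" "distinct [p, a, b, c]" "\<not> adjacent H p a"
    and "\<not> adjacent H p b \<or> {p, b, c} \<in> H"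
  shows "cycles (H \<union> cone p a b c) =
    (\<lambda>(d, \<alpha>) s. d s + \<alpha> * tetrahedron p a b c s) ` (cycles H \<times> UNIV)"
proof -
  let ?G = "H \<union> cone p a b c" and ?z = "tetrahedron p a b c"
  have fin: "finite ?G"
    using assms(1) by (simp add: cone_def)
  have z: "?z \<in> cycles ?G"
  proof -
    have "?z \<in> words (insert {a, b, c} (cone p a b c))"
      by (simp add: words_def tetrahedron_def)
    then show ?thesis
      using cycles_superset_iff[OF fin, of "insert {a, b, c} (cone p a b c)" ?z]
        tetrahedron_cycle[OF assms(3)] assms(2) by blast
  qed
  have down: "(\<lambda>s. d s + d {p, a, b} * ?z s) \<in> cycles H" if "d \<in> cycles ?G" for d
  proof -
    let ?d = "\<lambda>s. d s + d {p, a, b} * ?z s"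
    have "?d s = 0" if "s \<notin> H" for s
    proof (cases "s \<in> cone p a b c")
      case True
      then have "d s = d {p, a, b}"
        using cone_constant[OF assms(1,3-5) \<open>d \<in> cycles ?G\<close>] that by blast
      with True show ?thesis
        by (simp add: tetrahedron_def)
    next
      case False
      with that \<open>d \<in> cycles ?G\<close> assms(2) show ?thesis
        by (auto simp: cycles_def words_def tetrahedron_def)
    qed
    then have "?d \<in> words H"
      by (simp add: words_def)
    then show ?thesis
      using cycles_superset_iff[OF fin, of H ?d] cycles_add_scaled[OF that z] by simp
  qed
  show ?thesis
  proof (intro set_eqI iffI)
    fix d assume d: "d \<in> cycles ?G"
    have "d = (\<lambda>s. (d s + d {p, a, b} * ?z s) + d {p, a, b} * ?z s)"
      by (simp add: add.assoc)
    with down[OF d] show "d \<in> (\<lambda>(d, \<alpha>) s. d s + \<alpha> * ?z s) ` (cycles H \<times> UNIV)"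
      by (intro image_eqI[of _ _ "(\<lambda>s. d s + d {p, a, b} * ?z s, d {p, a, b})"]) auto
  next
    fix d assume "d \<in> (\<lambda>(d, \<alpha>) s. d s + \<alpha> * ?z s) ` (cycles H \<times> UNIV)"
    then obtain d' \<alpha> where d': "d' \<in> cycles H" "d = (\<lambda>s. d' s + \<alpha> * ?z s)"
      by auto
    then have "d' \<in> cycles ?G"
      using cycles_superset_iff[OF fin, of H d'] by (simp add: cycles_def)
    with d' z show "d \<in> cycles ?G"
      using cycles_add_scaled by blast
  qed
qed

definition subdivide :: "'v set set \<Rightarrow> 'v \<Rightarrow> 'v \<Rightarrow> 'v \<Rightarrow> 'v \<Rightarrow> 'v set set" where
  "subdivide H p a b c = H - {{a, b, c}} \<union> cone p a b c"

text \<open>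
  Deleting the triangle after attaching the cone selects the sums \<open>d + \<alpha> * tetrahedron\<close> that vanish
  on it, that is \<open>\<alpha> = d {a, b, c}\<close>: the extra dimension disappears again.
\<close>
lemma cycles_subdivide:
  assumes "finite H" "{a, b, c} \<in> H" "distinct [p, a, b, c]" "\<not> adjacent H p a"
    and "\<not> adjacent H p b \<or> {p, b, c} \<in> H"
  shows "bij_betw (\<lambda>d s. d s + d {a, b, c} * tetrahedron p a b c s)
    (cycles H) (cycles (subdivide H p a b c))"
proof -
  let ?z = "tetrahedron p a b c" and ?G = "H \<union> cone p a b c"
  have "{a, b, c} \<notin> cone p a b c"
    using assms(3) by (auto simp: cone_def)
  then have eq: "subdivide H p a b c = ?G - {{a, b, c}}"
    by (auto simp: subdivide_def)
  have fin: "finite ?G"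
    using assms(1) by (simp add: cone_def)
  have z1: "?z {a, b, c} = 1"
    by (simp add: tetrahedron_def)
  have "(\<lambda>d s. d s + d {a, b, c} * ?z s) ` cycles H = cycles (subdivide H p a b c)"
    unfolding eq cycles_remove_triangle[OF fin] cycles_attach_cone[OF assms]
  proof (intro set_eqI iffI)
    fix d assume "d \<in> {d \<in> (\<lambda>(d, \<alpha>) s. d s + \<alpha> * ?z s) ` (cycles H \<times> UNIV). d {a, b, c} = 0}"
    then obtain d' \<alpha> where d': "d' \<in> cycles H" "d = (\<lambda>s. d' s + \<alpha> * ?z s)" and "d {a, b, c} = 0"
      by auto
    then have "d' {a, b, c} = \<alpha>"
      using z1 by (cases "d' {a, b, c}"; cases \<alpha>) auto
    with d' show "d \<in> (\<lambda>d s. d s + d {a, b, c} * ?z s) ` cycles H"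
      by blast
  next
    fix d assume "d \<in> (\<lambda>d s. d s + d {a, b, c} * ?z s) ` cycles H"
    then obtain d' where "d' \<in> cycles H" and d: "d = (\<lambda>s. d' s + d' {a, b, c} * ?z s)"
      by blast
    then have "d \<in> (\<lambda>(d, \<alpha>) s. d s + \<alpha> * ?z s) ` (cycles H \<times> UNIV)"
      by (intro image_eqI[of _ _ "(d', d' {a, b, c})"]) auto
    moreover have "d {a, b, c} = 0"
      using d z1 by simp
    ultimately show "d \<in> {d \<in> (\<lambda>(d, \<alpha>) s. d s + \<alpha> * ?z s) ` (cycles H \<times> UNIV). d {a, b, c} = 0}"
      by simp
  qed
  moreover have "inj_on (\<lambda>d s. d s + d {a, b, c} * ?z s) (cycles H)"
  proof (rule inj_onI, rule ext)
    fix d d' s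
    assume d: "d \<in> cycles H" "d' \<in> cycles H"
      and same: "(\<lambda>s. d s + d {a, b, c} * ?z s) = (\<lambda>s. d' s + d' {a, b, c} * ?z s)"
    \<comment> \<open>On a new triangle the image of a cycle has the value that the cycle had on \<open>{a, b, c}\<close>.\<close>
    have new: "\<exists>s. s \<in> cone p a b c - H"
      using assms(4) by (intro exI[of _ "{p, a, b}"]) (auto simp: cone_def adjacent_def)
    then obtain s0 where s0: "s0 \<in> cone p a b c - H" ..
    then have "d s0 = 0" "d' s0 = 0" "?z s0 = 1"
      using d by (auto simp: cycles_def words_def tetrahedron_def)
    with fun_cong[OF same, of s0] have "d {a, b, c} = d' {a, b, c}"
      by simp
    with fun_cong[OF same, of s] show "d s = d' s"
      by simp
  qed
  ultimately show ?thesis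
    by (simp add: bij_betw_def)
qed

section \<open>Codes read off on marked triangles\<close>

text \<open>
  The value \<open>0\<close> outside the index set makes the readout a word, so that it can be compared with
  the elements of a code.
\<close>
definition readout :: "('i \<Rightarrow> 'v set) \<Rightarrow> 'i set \<Rightarrow> ('v set \<Rightarrow> bit) \<Rightarrow> 'i \<Rightarrow> bit" where
  "readout \<tau> E c = (\<lambda>i. if i \<in> E then c (\<tau> i) else 0)"

text \<open>
  Distinct marks make every coordinate of a word count separately in the weight of its cycle, and
  the bijection makes each word count once.
\<close>
definition realizes ::
    "'v set set \<Rightarrow> ('i \<Rightarrow> 'v set) \<Rightarrow> 'i set \<Rightarrow> ('i \<Rightarrow> bit) set \<Rightarrow> bool" where
  "realizes H \<tau> E C \<longleftrightarrow>
     triple_system H \<and> inj_on \<tau> E \<and> \<tau> ` E \<subseteq> H \<and> bij_betw (readout \<tau> E) (cycles H) C"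

lemma triple_system_subdivide:
  assumes "triple_system H" "distinct [p, a, b, c]"
  shows "triple_system (subdivide H p a b c)"
  using assms by (auto simp: triple_system_def subdivide_def cone_def)

lemma adjacent_subdivide:
  assumes "adjacent (subdivide H p a b c) u v" "{a, b, c} \<in> H"
  shows "adjacent H u v \<or> u = p \<and> v \<in> {p, a, b, c} \<or> v = p \<and> u \<in> {p, a, b, c}"
proof -
  obtain t where t: "t \<in> subdivide H p a b c" "u \<in> t" "v \<in> t"
    using assms(1) by (auto simp: adjacent_def)
  show ?thesis
  proof (cases "t \<in> H")
    case True
    with t show ?thesis by (auto simp: adjacent_def)
  next
    case False
    with t have "u \<in> {p, a, b, c}" "v \<in> {p, a, b, c}"
      by (auto simp: subdivide_def cone_def)
    moreover have "adjacent H u v" if "u \<in> {a, b, c}" "v \<in> {a, b, c}"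
      unfolding adjacent_def using that assms(2) by (intro bexI[of _ "{a, b, c}"]) simp_all
    ultimately show ?thesis
      by blast
  qed
qed

text \<open>
  What the exchange of a marked triangle for a cone does to the code: the mark moves to a new
  triangle of the cone, which has inherited its value, while every other marked triangle that
  happens to lie in the cone receives that value on top of its own.
\<close>
lemma realizes_subdivide:
  assumes real: "realizes H \<tau> E C" and k: "k \<in> E" "\<tau> k = {a, b, c}"
    and apex: "distinct [p, a, b, c]" "\<not> adjacent H p a"
    and base: "\<not> adjacent H p b \<or> {p, b, c} \<in> H"
    and s: "s \<in> cone p a b c - H"
  shows "realizes (subdivide H p a b c) (\<tau>(k := s)) E
    ((\<lambda>(d :: _ \<Rightarrow> bit) i. d i + of_bool (i \<in> E - {k} \<and> \<tau> i \<in> cone p a b c) * d k) ` C)"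
proof -
  let ?\<phi> = "\<lambda>d s. d s + d {a, b, c} * tetrahedron p a b c s"
  let ?f = "\<lambda>(d :: _ \<Rightarrow> bit) i. d i + of_bool (i \<in> E - {k} \<and> \<tau> i \<in> cone p a b c) * d k"
  have H: "triple_system H" "inj_on \<tau> E" "\<tau> ` E \<subseteq> H"
    and C: "bij_betw (readout \<tau> E) (cycles H) C"
    using real by (auto simp: realizes_def)
  have t: "{a, b, c} \<in> H"
    using H(3) k by blast
  have other: "\<tau> i \<in> H - {{a, b, c}}" if "i \<in> E" "i \<noteq> k" for i
  proof -
    have "\<tau> i \<noteq> \<tau> k"
      using that H(2) k(1) by (auto dest: inj_onD)
    with that H(3) k(2) show ?thesis
      by auto
  qed
  have inj: "inj_on (\<tau>(k := s)) E"
    using H(2,3) s by (intro inj_on_fun_updI) auto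
  have into: "(\<tau>(k := s)) ` E \<subseteq> subdivide H p a b c"
    using other s by (auto simp: subdivide_def)
  have \<phi>: "bij_betw ?\<phi> (cycles H) (cycles (subdivide H p a b c))"
    using cycles_subdivide[OF triple_system_finite[OF H(1)] t apex base] .
  have comm: "readout (\<tau>(k := s)) E (?\<phi> d) = ?f (readout \<tau> E d)" if "d \<in> cycles H" for d
  proof
    fix i
    have "d s = 0"
      using that s by (auto simp: cycles_def words_def)
    moreover have "tetrahedron p a b c s = 1"
      using s by (simp add: tetrahedron_def)
    moreover have "tetrahedron p a b c (\<tau> i) = of_bool (\<tau> i \<in> cone p a b c)"
      if "i \<in> E" "i \<noteq> k"
      using other[OF that] by (simp add: tetrahedron_def)
    ultimately show "readout (\<tau>(k := s)) E (?\<phi> d) i = ?f (readout \<tau> E d) i"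
      using k by (auto simp: readout_def)
  qed
  have "inj_on ?f C"
  proof (rule inj_onI, rule ext)
    fix d d' i assume same: "?f d = ?f d'"
    from fun_cong[OF same, of k] have "d k = d' k"
      by simp
    with fun_cong[OF same, of i] show "d i = d' i"
      by simp
  qed
  then have "bij_betw ?f C (?f ` C)"
    by (simp add: bij_betw_def)
  with C have "bij_betw (?f \<circ> readout \<tau> E) (cycles H) (?f ` C)"
    by (rule bij_betw_trans)
  then have "bij_betw (readout (\<tau>(k := s)) E \<circ> ?\<phi>) (cycles H) (?f ` C)"
    by (rule iffD1[OF bij_betw_cong, rotated]) (simp add: comm)
  then have "bij_betw (readout (\<tau>(k := s)) E) (cycles (subdivide H p a b c)) (?f ` C)"
    using \<phi> bij_betw_comp_iff by blast
  then show ?thesis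
    using triple_system_subdivide[OF H(1) apex(1)] inj into by (simp add: realizes_def)
qed

text \<open>
  A cone that meets the system only along the boundary of \<open>{a, b, c}\<close> just moves the mark. The
  new adjacencies are recorded because later moves need edges that are still unused.
\<close>
lemma slide_triangle:
  assumes real: "realizes H \<tau> E C" and k: "k \<in> E" "\<tau> k = {a, b, c}"
    and apex: "distinct [p, a, b, c]" "\<not> adjacent H p a" "\<not> adjacent H p b"
    and s: "s \<in> cone p a b c"
  obtains H' \<tau>' where "realizes H' \<tau>' E C" "\<tau>' k = s" "\<And>i. i \<noteq> k \<Longrightarrow> \<tau>' i = \<tau> i"
    "\<And>u v. adjacent H' u v \<Longrightarrow>
      adjacent H u v \<or> u = p \<and> v \<in> {p, a, b, c} \<or> v = p \<and> u \<in> {p, a, b, c}"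
proof
  have new: "cone p a b c \<inter> H = {}"
  proof -
    have "\<not> {p, a, v} \<subseteq> t" "\<not> {p, b, v} \<subseteq> t" if "t \<in> H" for t v
      using apex(2,3) that by (auto simp: adjacent_def)
    then show ?thesis
      by (fastforce simp: cone_def)
  qed
  have H: "\<tau> ` E \<subseteq> H"
    using real by (simp add: realizes_def)
  have "(\<lambda>(d :: _ \<Rightarrow> bit) i. d i + of_bool (i \<in> E - {k} \<and> \<tau> i \<in> cone p a b c) * d k) = (\<lambda>d. d)"
    using new H by (intro ext) auto
  moreover have "realizes (subdivide H p a b c) (\<tau>(k := s)) E
      ((\<lambda>(d :: _ \<Rightarrow> bit) i. d i + of_bool (i \<in> E - {k} \<and> \<tau> i \<in> cone p a b c) * d k) ` C)"
    by (rule realizes_subdivide[OF real k apex(1,2)]) (use apex(3) s new in blast)+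
  ultimately show "realizes (subdivide H p a b c) (\<tau>(k := s)) E C"
    by (simp only: image_ident)
  show "adjacent H u v \<or> u = p \<and> v \<in> {p, a, b, c} \<or> v = p \<and> u \<in> {p, a, b, c}"
    if "adjacent (subdivide H p a b c) u v" for u v
    using adjacent_subdivide[OF that] H k by blast
qed auto

text \<open>The last move of a tube: the cone contains the marked triangle \<open>j\<close>, which absorbs the value.\<close>
lemma merge_triangle:
  assumes real: "realizes H \<tau> E C" and k: "k \<in> E" "\<tau> k = {a, b, c}"
    and j: "j \<in> E" "\<tau> j = {p, b, c}" "j \<noteq> k"
    and apex: "distinct [p, a, b, c]" "\<not> adjacent H p a"
  shows "realizes (subdivide H p a b c) (\<tau>(k := {p, a, b})) E ((\<lambda>d. d(j := d j + d k)) ` C)"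
proof -
  have H: "inj_on \<tau> E" "\<tau> ` E \<subseteq> H"
    using real by (auto simp: realizes_def)
  have new: "{p, a, b} \<notin> H" "{p, a, c} \<notin> H"
    using apex by (auto simp: adjacent_def)
  have only_j: "i \<in> E - {k} \<and> \<tau> i \<in> cone p a b c \<longleftrightarrow> i = j" for i
  proof
    assume i: "i \<in> E - {k} \<and> \<tau> i \<in> cone p a b c"
    then have "\<tau> i = \<tau> j"
      using H(2) new j(2) by (auto simp: cone_def)
    with i j(1) show "i = j"
      using inj_onD[OF H(1)] by blast
  qed (use j in \<open>auto simp: cone_def\<close>)
  have "(\<lambda>(d :: _ \<Rightarrow> bit) i. d i + of_bool (i \<in> E - {k} \<and> \<tau> i \<in> cone p a b c) * d k) =
      (\<lambda>d. d(j := d j + d k))"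
    unfolding only_j by (intro ext) simp
  moreover have "realizes (subdivide H p a b c) (\<tau>(k := {p, a, b})) E
      ((\<lambda>(d :: _ \<Rightarrow> bit) i. d i + of_bool (i \<in> E - {k} \<and> \<tau> i \<in> cone p a b c) * d k) ` C)"
    by (rule realizes_subdivide[OF real k apex]) (use H(2) j new in \<open>auto simp: cone_def\<close>)
  ultimately show ?thesis
    by (simp only:)
qed

section \<open>Row operations\<close>

lemma finite_vertices_bound:
  assumes "triple_system H"
  obtains M :: nat where "\<forall>v\<in>\<Union>H. v < M"
  using finite_vertices[OF assms] finite_nat_set_iff_bounded by blast

text \<open>
  The moves towards a triangle \<open>j\<close> create edges from the vertices of \<open>j\<close> to two vertices of the
  moving triangle, and these edges must not be in use. The triangles \<open>j\<close> and \<open>k\<close> may share vertices,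
  so \<open>k\<close> is first moved away from all old vertices.

  For this the marked triangle runs along a sequence of vertices whose first three are its corners
  and whose further ones are new, always as a window of three consecutive vertices. Each vertex
  becomes adjacent only to those at most three places away, hence after five moves the last two
  vertices, at places 6 and 7, have no neighbour among the places 0, 1, 2 and so none among the
  old vertices.
\<close>
lemma realizes_remote_triangle:
  fixes H :: "nat set set"
  assumes real: "realizes H \<tau> E C" and k: "k \<in> E"
  obtains H' :: "nat set set" and \<tau>' x y z
  where "realizes H' \<tau>' E C" "\<And>i. i \<noteq> k \<Longrightarrow> \<tau>' i = \<tau> i"
    "\<tau>' k = {x, y, z}" "distinct [x, y, z]" "{x, y, z} \<inter> \<Union>H = {}"
    "\<And>v. v \<in> \<Union>H \<Longrightarrow> \<not> adjacent H' v x \<and> \<not> adjacent H' v y"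
proof -
  have H: "triple_system H" "\<tau> k \<in> H"
    using real k by (auto simp: realizes_def)
  then obtain a b c where abc: "\<tau> k = {a, b, c}" "distinct [a, b, c]"
    by (auto simp: triple_system_def card_3_iff)
  obtain M where M: "\<forall>v\<in>\<Union>H. v < M"
    using finite_vertices_bound[OF H(1)] .
  have old: "a < M" "b < M" "c < M"
    using M H(2) abc(1) by blast+
  define x where "x i = (if i = 0 then c else if i = 1 then b else if i = 2 then a else M + i)" for i
  have inj: "x i = x j \<longleftrightarrow> i = j" for i j
    using old abc(2) by (auto simp: x_def)
  have far: "x i \<notin> \<Union>H" if "3 \<le> i" for i
    using M that by (auto simp: x_def)
  have "\<exists>(H' :: nat set set) \<tau>'. realizes H' \<tau>' E C \<and> (\<forall>i. i \<noteq> k \<longrightarrow> \<tau>' i = \<tau> i) \<and>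
      \<tau>' k = {x (n + 2), x (n + 1), x n} \<and>
      (\<forall>u v. adjacent H' u v \<longrightarrow> adjacent H u v \<or>
        (\<exists>i j. u = x i \<and> v = x j \<and> i \<le> n + 2 \<and> j \<le> n + 2 \<and> i \<le> j + 3 \<and> j \<le> i + 3))" for n
  proof (induction n)
    case 0
    have "\<tau> k = {x 2, x 1, x 0}"
      using abc(1) by (simp add: x_def)
    then show ?case
      using real by (intro exI[of _ H] exI[of _ \<tau>]) (simp add: numeral_2_eq_2)
  next
    case (Suc n)
    then obtain H1 :: "nat set set" and \<tau>1 where H1: "realizes H1 \<tau>1 E C"
      and other: "\<And>i. i \<noteq> k \<Longrightarrow> \<tau>1 i = \<tau> i" and tri: "\<tau>1 k = {x (n + 2), x (n + 1), x n}"
      and adj: "\<And>u v. adjacent H1 u v \<Longrightarrow> adjacent H u v \<or>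
        (\<exists>i j. u = x i \<and> v = x j \<and> i \<le> n + 2 \<and> j \<le> n + 2 \<and> i \<le> j + 3 \<and> j \<le> i + 3)"
      by blast
    have fresh: "\<not> adjacent H1 (x (n + 3)) v" for v
    proof
      assume "adjacent H1 (x (n + 3)) v"
      then have "adjacent H (x (n + 3)) v \<or> (\<exists>i. x (n + 3) = x i \<and> i \<le> n + 2)"
        using adj by blast
      then show False
        using far[of "n + 3"] by (auto simp: adjacent_def inj)
    qed
    have apex: "distinct [x (n + 3), x (n + 2), x (n + 1), x n]"
      by (simp add: inj)
    have side: "{x (n + 3), x (n + 2), x (n + 1)} \<in> cone (x (n + 3)) (x (n + 2)) (x (n + 1)) (x n)"
      by (simp add: cone_def)
    obtain H2 \<tau>2 where H2: "realizes H2 \<tau>2 E C" "\<tau>2 k = {x (n + 3), x (n + 2), x (n + 1)}"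
      "\<And>i. i \<noteq> k \<Longrightarrow> \<tau>2 i = \<tau>1 i"
      and adj': "\<And>u v. adjacent H2 u v \<Longrightarrow> adjacent H1 u v
        \<or> u = x (n + 3) \<and> v \<in> {x (n + 3), x (n + 2), x (n + 1), x n}
        \<or> v = x (n + 3) \<and> u \<in> {x (n + 3), x (n + 2), x (n + 1), x n}"
      by (rule slide_triangle[OF H1 k tri apex fresh fresh side]) (rule that; assumption)
    have near: "\<exists>j. v = x j \<and> j \<le> n + 3 \<and> n \<le> j"
      if "v \<in> {x (n + 3), x (n + 2), x (n + 1), x n}" for v
      using that by (auto intro: exI[of _ "n + 3"] exI[of _ "n + 2"] exI[of _ "n + 1"] exI[of _ n])
    have "adjacent H u v \<or>
        (\<exists>i j. u = x i \<and> v = x j \<and> i \<le> n + 3 \<and> j \<le> n + 3 \<and> i \<le> j + 3 \<and> j \<le> i + 3)"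
      if uv: "adjacent H2 u v" for u v
    proof -
      consider "adjacent H1 u v"
        | "u = x (n + 3)" "v \<in> {x (n + 3), x (n + 2), x (n + 1), x n}"
        | "v = x (n + 3)" "u \<in> {x (n + 3), x (n + 2), x (n + 1), x n}"
        using adj'[OF uv] by blast
      then show ?thesis
      proof cases
        case 1
        then show ?thesis
          using adj[of u v] by fastforce
      next
        case 2
        then obtain j where "v = x j" "j \<le> n + 3" "n \<le> j"
          using near by blast
        with 2(1) show ?thesis
          by (intro disjI2 exI[of _ "n + 3"] exI[of _ j]) simp
      next
        case 3
        then obtain j where "u = x j" "j \<le> n + 3" "n \<le> j"
          using near by blast
        with 3(1) show ?thesis
          by (intro disjI2 exI[of _ j] exI[of _ "n + 3"]) simp
      qed
    qed
    then show ?case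
      using H2 other by (intro exI[of _ H2] exI[of _ \<tau>2]) (simp add: numeral_eq_Suc)
  qed
  from this[of 5] obtain H' :: "nat set set" and \<tau>' where H': "realizes H' \<tau>' E C"
    "\<And>i. i \<noteq> k \<Longrightarrow> \<tau>' i = \<tau> i" "\<tau>' k = {x (5 + 2), x (5 + 1), x 5}"
    and adj: "\<And>u v. adjacent H' u v \<Longrightarrow> adjacent H u v \<or>
      (\<exists>i j. u = x i \<and> v = x j \<and> i \<le> 5 + 2 \<and> j \<le> 5 + 2 \<and> i \<le> j + 3 \<and> j \<le> i + 3)"
    by blast
  have "\<not> adjacent H' v (x m)" if v: "v \<in> \<Union>H" and m: "6 \<le> m" for v m
  proof
    assume "adjacent H' v (x m)"
    moreover have "\<not> adjacent H v (x m)"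
      using far[of m] m by (auto simp: adjacent_def)
    ultimately obtain i where "v = x i" "m \<le> i + 3"
      using adj[of v "x m"] by (auto simp: inj)
    then show False
      using v m far[of i] by simp
  qed
  then show ?thesis
    using H' far by (intro that[of H' \<tau>' "x 7" "x 6" "x 5"]) (auto simp: inj)
qed

text \<open>
  Once the moving triangle \<open>{x, y, z}\<close> is remote from \<open>{p, q, r}\<close>, it moves through \<open>{p, x, y}\<close> and
  \<open>{q, x, p}\<close>. The cone over the latter from \<open>r\<close> contains \<open>{p, q, r}\<close>, and its new triangles are
  joined by the unused edge \<open>{r, x}\<close>.
\<close>
lemma realizes_row_operation:
  fixes H :: "nat set set"
  assumes real: "realizes H \<tau> E C" and E: "k \<in> E" "j \<in> E" "j \<noteq> k"
  obtains H' :: "nat set set" and \<tau>' where "realizes H' \<tau>' E ((\<lambda>d. d(j := d j + d k)) ` C)"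
proof -
  have H: "triple_system H" "\<tau> j \<in> H"
    using real E by (auto simp: realizes_def)
  then obtain p q r where j: "\<tau> j = {p, q, r}" "distinct [p, q, r]"
    by (auto simp: triple_system_def card_3_iff)
  have old: "p \<in> \<Union>H" "q \<in> \<Union>H" "r \<in> \<Union>H"
    using H(2) j(1) by blast+
  obtain H1 :: "nat set set" and \<tau>1 x y z where 1: "realizes H1 \<tau>1 E C"
    "\<And>i. i \<noteq> k \<Longrightarrow> \<tau>1 i = \<tau> i" "\<tau>1 k = {x, y, z}"
    and xyz: "distinct [x, y, z]" "{x, y, z} \<inter> \<Union>H = {}"
    and far: "\<And>v. v \<in> \<Union>H \<Longrightarrow> \<not> adjacent H1 v x \<and> \<not> adjacent H1 v y"
    using realizes_remote_triangle[OF real E(1)] by blast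
  have ne: "v \<noteq> x" "v \<noteq> y" "v \<noteq> z" if "v \<in> \<Union>H" for v
    using that xyz(2) by auto
  note ne' = ne[OF old(1)] ne[OF old(2)] ne[OF old(3)]
  have "distinct [p, x, y, z]"
    using xyz(1) ne' by simp
  moreover have "\<not> adjacent H1 p x" "\<not> adjacent H1 p y"
    using far[OF old(1)] by blast+
  moreover have "{p, x, y} \<in> cone p x y z"
    by (simp add: cone_def)
  ultimately obtain H2 \<tau>2 where 2: "realizes H2 \<tau>2 E C" "\<tau>2 k = {p, x, y}"
    "\<And>i. i \<noteq> k \<Longrightarrow> \<tau>2 i = \<tau>1 i"
    and adj2: "\<And>u v. adjacent H2 u v \<Longrightarrow>
      adjacent H1 u v \<or> u = p \<and> v \<in> {p, x, y, z} \<or> v = p \<and> u \<in> {p, x, y, z}"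
    by (rule slide_triangle[OF 1(1) E(1) 1(3)]) (rule that; assumption)
  have slid: "\<tau>2 k = {x, y, p}"
    using 2(2) by (simp add: insert_commute)
  have "distinct [q, x, y, p]"
    using xyz(1) ne' j(2) by auto
  moreover have "\<not> adjacent H2 q x" "\<not> adjacent H2 q y"
    using adj2[of q x] adj2[of q y] far[OF old(2)] ne' j(2) by auto
  moreover have "{q, x, p} \<in> cone q x y p"
    by (simp add: cone_def)
  ultimately obtain H3 \<tau>3 where 3: "realizes H3 \<tau>3 E C" "\<tau>3 k = {q, x, p}"
    "\<And>i. i \<noteq> k \<Longrightarrow> \<tau>3 i = \<tau>2 i"
    and adj3: "\<And>u v. adjacent H3 u v \<Longrightarrow>
      adjacent H2 u v \<or> u = q \<and> v \<in> {q, x, y, p} \<or> v = q \<and> u \<in> {q, x, y, p}"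
    by (rule slide_triangle[OF 2(1) E(1) slid]) (rule that; assumption)
  have slid: "\<tau>3 k = {x, q, p}"
    using 3(2) by (simp add: insert_commute)
  have "distinct [r, x, q, p]"
    using ne' j(2) by auto
  moreover have "\<not> adjacent H3 r x"
    using adj3[of r x] adj2[of r x] far[OF old(3)] ne' j(2) by auto
  moreover have "\<tau>3 j = {r, q, p}"
    using 1(2) 2(3) 3(3) E(3) j(1) by (simp add: insert_commute)
  ultimately show ?thesis
    using that merge_triangle[OF 3(1) E(1) slid E(2) _ E(3)] by blast
qed

section \<open>Realizing every code\<close>

lemma cycles_isolated_triangle:
  assumes "finite H" "x \<notin> \<Union>H" "distinct [x, y, z]"
  shows "cycles (insert {x, y, z} H) = cycles H"
proof -
  let ?t = "{x, y, z}"
  have new: "?t \<notin> H"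
    using assms(2) by blast
  have "d ?t = 0" if "d \<in> cycles (insert ?t H)" for d
  proof -
    \<comment> \<open>The new triangle is the only one around the pair \<open>{x, y}\<close>.\<close>
    have "(\<Sum>t\<in>insert ?t H. incidence {x, y} t * d t) = 0"
      using that assms(3) by (simp add: cycles_def)
    moreover have "(\<Sum>t\<in>H. incidence {x, y} t * d t) = 0"
      using assms(2) by (intro sum.neutral) (auto simp: incidence_def)
    ultimately show ?thesis
      using assms(1) new by (simp add: incidence_def)
  qed
  moreover have "insert ?t H - {?t} = H"
    using new by blast
  ultimately show ?thesis
    using cycles_remove_triangle[of "insert ?t H" ?t] assms(1) by auto
qed

lemma realizes_zero_coordinate:
  assumes real: "realizes H \<tau> E C" and k: "k \<notin> E"
    and fresh: "x \<notin> \<Union>H" "distinct [x, y, z]"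
  shows "realizes (insert {x, y, z} H) (\<tau>(k := {x, y, z})) (insert k E) C"
proof -
  let ?t = "{x, y, z}"
  have H: "triple_system H" "inj_on \<tau> E" "\<tau> ` E \<subseteq> H" "bij_betw (readout \<tau> E) (cycles H) C"
    using real by (auto simp: realizes_def)
  have new: "?t \<notin> H"
    using fresh(1) by blast
  have "readout (\<tau>(k := ?t)) (insert k E) d = readout \<tau> E d" if "d \<in> cycles H" for d
    using that new k by (auto simp: readout_def cycles_def words_def)
  then have "bij_betw (readout (\<tau>(k := ?t)) (insert k E)) (cycles (insert ?t H)) C"
    using H(4) unfolding cycles_isolated_triangle[OF triple_system_finite[OF H(1)] fresh]
    by (simp cong: bij_betw_cong)
  moreover have "inj_on (\<tau>(k := ?t)) (insert k E)"
  proof -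
    have "inj_on (\<tau>(k := ?t)) E"
      using H(2) by (rule inj_on_fun_updI) (use H(3) new in blast)
    moreover have "?t \<notin> (\<tau>(k := ?t)) ` E"
      using H(3) new k by auto
    ultimately show ?thesis
      using k by simp
  qed
  moreover have "triple_system (insert ?t H)"
    using H(1) fresh(2) by (simp add: triple_system_def)
  ultimately show ?thesis
    using H(3) by (auto simp: realizes_def)
qed

definition realizable :: "'i set \<Rightarrow> ('i \<Rightarrow> bit) set \<Rightarrow> bool" where
  "realizable E C \<longleftrightarrow> (\<exists>(H :: nat set set) \<tau>. realizes H \<tau> E C)"

lemma realizable_zero_code:
  assumes "finite E"
  shows "realizable E {\<lambda>_. 0}"
  using assms
proof induction
  case empty
  have "cycles ({} :: nat set set) = {\<lambda>_. 0}"
    by (auto simp: cycles_def words_def)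
  then have "realizes ({} :: nat set set) (\<lambda>_. {}) {} {\<lambda>_. 0}"
    by (simp add: realizes_def triple_system_def readout_def bij_betw_def)
  then show ?case
    unfolding realizable_def by blast
next
  case (insert k E)
  then obtain H :: "nat set set" and \<tau> where real: "realizes H \<tau> E {\<lambda>_. 0}"
    by (auto simp: realizable_def)
  then obtain M where "\<forall>v\<in>\<Union>H. v < M"
    using finite_vertices_bound by (auto simp: realizes_def)
  then have "M \<notin> \<Union>H"
    by blast
  from realizes_zero_coordinate[OF real insert.hyps(2) this, of "M + 1" "M + 2"]
  have "realizes (insert {M, M + 1, M + 2} H) (\<tau>(k := {M, M + 1, M + 2})) (insert k E) {\<lambda>_. 0}"
    by simp
  then show ?case
    unfolding realizable_def by blast
qed

text \<open>
  The free value comes from a disjoint tetrahedron boundary, obtained by attaching a cone to an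
  isolated triangle. The isolated triangle alone carries the value \<open>0\<close>, so the multiple of the
  tetrahedron is the only contribution there.
\<close>
lemma realizable_free_coordinate:
  assumes "realizable E C" and k: "k \<notin> E"
  shows "realizable (insert k E) ((\<lambda>(d, \<alpha>). d(k := \<alpha>)) ` (C \<times> UNIV))"
proof -
  obtain H :: "nat set set" and \<tau> where real: "realizes H \<tau> E C"
    using assms(1) by (auto simp: realizable_def)
  then have H: "triple_system H" "\<tau> ` E \<subseteq> H" "bij_betw (readout \<tau> E) (cycles H) C"
    by (auto simp: realizes_def)
  obtain M where M: "\<forall>v\<in>\<Union>H. v < M"
    using finite_vertices_bound[OF H(1)] .
  let ?t = "{M, M + 1, M + 2}" and ?cone = "cone (M + 3) M (M + 1) (M + 2)"
    and ?z = "tetrahedron (M + 3) M (M + 1) (M + 2)"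
  let ?H = "insert ?t H" and ?\<tau> = "\<tau>(k := ?t)"
  have fresh: "M \<notin> \<Union>H" "distinct [M, M + 1, M + 2]"
    using M by auto
  have real': "realizes ?H ?\<tau> (insert k E) C"
    using realizes_zero_coordinate[OF real k fresh] .
  have same: "cycles ?H = cycles H"
    using cycles_isolated_triangle[OF triple_system_finite[OF H(1)] fresh] .
  have "finite ?H" "?t \<in> ?H" "distinct [M + 3, M, M + 1, M + 2]"
    "\<not> adjacent ?H (M + 3) M" "\<not> adjacent ?H (M + 3) (M + 1) \<or> {M + 3, M + 1, M + 2} \<in> ?H"
    using triple_system_finite[OF H(1)] M by (auto simp: adjacent_def)
  from cycles_attach_cone[OF this]
  have cyc: "cycles (?H \<union> ?cone) = (\<lambda>(d, \<alpha>) s. d s + \<alpha> * ?z s) ` (cycles H \<times> UNIV)"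
    unfolding same .
  have z0: "?z t = 0" if "t \<in> H" for t
  proof -
    have "M \<notin> t" "M + 3 \<notin> t"
      using that M by auto
    then show ?thesis
      by (auto simp: tetrahedron_def cone_def)
  qed
  have tr: "readout ?\<tau> (insert k E) (\<lambda>s. d s + \<alpha> * ?z s) = (readout \<tau> E d)(k := \<alpha>)"
    if "d \<in> cycles H" for d \<alpha>
  proof
    fix i
    have "d ?t = 0"
      using that fresh(1) by (auto simp: cycles_def words_def)
    moreover have "?z ?t = 1"
      by (simp add: tetrahedron_def)
    moreover have "?z (\<tau> i) = 0" if "i \<in> E"
      using that H(2) z0 by blast
    ultimately show "readout ?\<tau> (insert k E) (\<lambda>s. d s + \<alpha> * ?z s) i = ((readout \<tau> E d)(k := \<alpha>)) i"
      using k by (simp add: readout_def)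
  qed
  have "inj_on (readout ?\<tau> (insert k E)) (cycles (?H \<union> ?cone))"
  proof (rule inj_onI)
    fix c c'
    assume "c \<in> cycles (?H \<union> ?cone)" "c' \<in> cycles (?H \<union> ?cone)"
    then obtain d \<alpha> d' \<alpha>' where d: "d \<in> cycles H" "d' \<in> cycles H"
      and c: "c = (\<lambda>s. d s + \<alpha> * ?z s)" "c' = (\<lambda>s. d' s + \<alpha>' * ?z s)"
      unfolding cyc by auto
    assume "readout ?\<tau> (insert k E) c = readout ?\<tau> (insert k E) c'"
    then have eq: "(readout \<tau> E d)(k := \<alpha>) = (readout \<tau> E d')(k := \<alpha>')"
      unfolding c tr[OF d(1)] tr[OF d(2)] .
    have "\<alpha> = \<alpha>'"
      using fun_cong[OF eq, of k] by simp
    moreover have "readout \<tau> E d i = readout \<tau> E d' i" for i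
      using fun_cong[OF eq, of i] k by (cases "i = k") (simp_all add: readout_def)
    then have "readout \<tau> E d = readout \<tau> E d'" ..
    then have "d = d'"
      using inj_onD[OF bij_betw_imp_inj_on[OF H(3)]] d by blast
    ultimately show "c = c'"
      unfolding c by simp
  qed
  moreover have "readout ?\<tau> (insert k E) ` cycles (?H \<union> ?cone) =
      (\<lambda>(d, \<alpha>). d(k := \<alpha>)) ` (C \<times> UNIV)"
  proof -
    have "readout ?\<tau> (insert k E) ` cycles (?H \<union> ?cone) =
        (\<lambda>(d, \<alpha>). (readout \<tau> E d)(k := \<alpha>)) ` (cycles H \<times> UNIV)"
      unfolding cyc image_image
      by (intro image_cong refl) (simp only: mem_Times_iff split_beta tr)
    also have "\<dots> = (\<lambda>(d, \<alpha>). d(k := \<alpha>)) ` (readout \<tau> E ` cycles H \<times> UNIV)"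
      by force
    finally show ?thesis
      using H(3) by (simp add: bij_betw_def)
  qed
  moreover have "triple_system (?H \<union> ?cone)"
    using real' by (auto simp: realizes_def triple_system_def cone_def)
  ultimately have "realizes (?H \<union> ?cone) ?\<tau> (insert k E) ((\<lambda>(d, \<alpha>). d(k := \<alpha>)) ` (C \<times> UNIV))"
    using real' by (auto simp: realizes_def bij_betw_def)
  then show ?thesis
    unfolding realizable_def by blast
qed

lemma realizable_row_operation:
  assumes "realizable E C" "k \<in> E" "j \<in> E" "j \<noteq> k"
  shows "realizable E ((\<lambda>d. d(j := d j + d k)) ` C)"
proof -
  obtain H :: "nat set set" and \<tau> where real: "realizes H \<tau> E C"
    using assms(1) by (auto simp: realizable_def)
  show ?thesis
    by (rule realizes_row_operation[OF real assms(2-4)]) (auto simp: realizable_def)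
qed

text \<open>A marked triangle can be unmarked as soon as the other marks still determine the cycle.\<close>
lemma realizable_puncture:
  assumes "realizable (insert k E) C" and "inj_on (\<lambda>d. d(k := 0)) C" and "k \<notin> E"
  shows "realizable E ((\<lambda>d. d(k := 0)) ` C)"
proof -
  obtain H :: "nat set set" and \<tau> where H: "triple_system H" "inj_on \<tau> (insert k E)"
    "\<tau> ` insert k E \<subseteq> H" "bij_betw (readout \<tau> (insert k E)) (cycles H) C"
    using assms(1) by (auto simp: realizable_def realizes_def)
  have "bij_betw (\<lambda>d. d(k := 0)) C ((\<lambda>d. d(k := 0)) ` C)"
    using assms(2) by (simp add: bij_betw_def)
  with H(4) have "bij_betw ((\<lambda>d. d(k := 0)) \<circ> readout \<tau> (insert k E)) (cycles H)
      ((\<lambda>d. d(k := 0)) ` C)"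
    by (rule bij_betw_trans)
  moreover have "(\<lambda>d. d(k := 0)) \<circ> readout \<tau> (insert k E) = readout \<tau> E"
    using assms(3) by (auto simp: readout_def fun_eq_iff)
  ultimately have "realizes H \<tau> E ((\<lambda>d. d(k := 0)) ` C)"
    using H by (auto simp: realizes_def)
  then show ?thesis
    unfolding realizable_def by blast
qed

text \<open>
  A free coordinate \<open>k\<close> with value \<open>\<alpha>\<close> is added by row operations to the coordinates in the support
  of \<open>b\<close>, which turns a word \<open>d\<close> into \<open>d + \<alpha> * b\<close>. These sums determine \<open>d\<close> and \<open>\<alpha>\<close> because \<open>b\<close> is
  not in \<open>C\<close>, so coordinate \<open>k\<close> can be dropped.
\<close>
lemma realizable_add_word:
  fixes E :: "nat set"
  assumes "finite E" and real: "realizable E C" and C: "C \<subseteq> words E" "bitvec.subspace C"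
    and b: "b \<in> words E" "b \<notin> C"
  shows "realizable E ((\<lambda>(d, \<alpha>) i. d i + \<alpha> * b i) ` (C \<times> UNIV))"
proof -
  obtain k where k: "k \<notin> E"
    using ex_new_if_finite[OF infinite_UNIV_nat assms(1)] by blast
  \<comment> \<open>The word reached when \<open>\<alpha>\<close> has been added on the part \<open>S\<close> of the support of \<open>b\<close>.\<close>
  define g where "g = (\<lambda>S (d, \<alpha>) i. if i = k then \<alpha> else d i + of_bool (i \<in> S) * \<alpha> :: bit)"
  have step: "realizable (insert k E) (g S ` (C \<times> UNIV))" if "finite S" "S \<subseteq> E" for S
    using that
  proof induction
    case empty
    have "g {} = (\<lambda>(d, \<alpha>). d(k := \<alpha>))"
      by (auto simp: g_def fun_eq_iff)
    then show ?case
      using realizable_free_coordinate[OF real k] by simp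
  next
    case (insert j S)
    then have j: "j \<in> E" "j \<noteq> k" "j \<notin> S"
      using k by auto
    have "(\<lambda>d. d(j := d j + d k)) ` g S ` (C \<times> UNIV) = g (insert j S) ` (C \<times> UNIV)"
      unfolding image_image using j by (intro image_cong) (auto simp: g_def fun_eq_iff)
    with insert j show ?case
      using realizable_row_operation[of "insert k E" "g S ` (C \<times> UNIV)" k j] by simp
  qed
  define S where "S = {i. b i = 1}"
  have S: "S \<subseteq> E"
    using b(1) by (auto simp: S_def words_def)
  have bi: "of_bool (i \<in> S) = b i" for i
    by (cases "b i") (auto simp: S_def)
  have zero: "d k = 0" if "d \<in> C" for d
    using that C(1) k by (auto simp: words_def)
  have bk: "b k = 0"
    using b(1) k by (auto simp: words_def)
  have g: "(g S (d, \<alpha>))(k := 0) = (\<lambda>i. d i + \<alpha> * b i)" if "d \<in> C" for d \<alpha>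
    using zero[OF that] bk by (auto simp: g_def bi fun_eq_iff mult.commute)
  have "inj_on (\<lambda>d. d(k := 0)) (g S ` (C \<times> UNIV))"
  proof (rule inj_onI)
    fix x x' assume "x \<in> g S ` (C \<times> UNIV)" "x' \<in> g S ` (C \<times> UNIV)"
    then obtain d \<alpha> d' \<alpha>' where d: "d \<in> C" "d' \<in> C" and x: "x = g S (d, \<alpha>)" "x' = g S (d', \<alpha>')"
      by blast
    assume "x(k := 0) = x'(k := 0)"
    then have eq: "d i + \<alpha> * b i = d' i + \<alpha>' * b i" for i
      unfolding x g[OF d(1)] g[OF d(2)] by (rule fun_cong)
    have "\<alpha> = \<alpha>'"
    proof (rule ccontr)
      assume "\<alpha> \<noteq> \<alpha>'"
      then have "b i = d i + d' i" for i
        using eq[of i] by (cases \<alpha>; cases \<alpha>'; cases "d i"; cases "d' i"; cases "b i") auto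
      then have "b = d + d'"
        by (auto simp: fun_eq_iff)
      then show False
        using b(2) d bitvec.subspace_add[OF C(2)] by blast
    qed
    moreover from this have "d = d'"
      using eq by (auto simp: fun_eq_iff)
    ultimately show "x = x'"
      by (simp add: x)
  qed
  moreover have "(\<lambda>d. d(k := 0)) ` g S ` (C \<times> UNIV) =
      (\<lambda>(d, \<alpha>) i. d i + \<alpha> * b i) ` (C \<times> UNIV)"
    unfolding image_image by (intro image_cong) (auto simp: g)
  ultimately show ?thesis
    using realizable_puncture[OF step[OF finite_subset[OF S assms(1)] S] _ k] by simp
qed

lemma subspace_words: "bitvec.subspace (words E)"
  unfolding bitvec.subspace_def by (auto simp: words_def)

lemma realizable_span:
  fixes E :: "nat set"
  assumes "finite E" "finite B" "B \<subseteq> words E"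
  shows "realizable E (bitvec.span B)"
  using assms(2,3)
proof induction
  case empty
  then show ?case
    using realizable_zero_code[OF assms(1)] by (simp add: zero_fun_def)
next
  case (insert b B)
  show ?case
  proof (cases "b \<in> bitvec.span B")
    case True
    with insert show ?thesis
      by (simp add: bitvec.span_redundant)
  next
    case False
    have sub: "bitvec.span B \<subseteq> words E"
      using insert.prems subspace_words by (intro bitvec.span_minimal) auto
    have "bitvec.span (insert b B) = (\<lambda>(d, \<alpha>) i. d i + \<alpha> * b i) ` (bitvec.span B \<times> UNIV)"
      unfolding bitvec.span_insert
    proof (intro set_eqI iffI)
      fix x assume "x \<in> {x. \<exists>\<alpha>. x - (\<lambda>i. \<alpha> * b i) \<in> bitvec.span B}"
      then obtain \<alpha> where "x - (\<lambda>i. \<alpha> * b i) \<in> bitvec.span B"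
        by blast
      moreover have "x = (\<lambda>i. (x - (\<lambda>i. \<alpha> * b i)) i + \<alpha> * b i)"
        by (simp add: fun_eq_iff add.assoc)
      ultimately show "x \<in> (\<lambda>(d, \<alpha>) i. d i + \<alpha> * b i) ` (bitvec.span B \<times> UNIV)"
        by (intro image_eqI[of _ _ "(x - (\<lambda>i. \<alpha> * b i), \<alpha>)"]) auto
    next
      fix x assume "x \<in> (\<lambda>(d, \<alpha>) i. d i + \<alpha> * b i) ` (bitvec.span B \<times> UNIV)"
      then obtain d \<alpha> where d: "d \<in> bitvec.span B" "x = (\<lambda>i. d i + \<alpha> * b i)"
        by auto
      then have "x - (\<lambda>i. \<alpha> * b i) = d"
        by (simp add: fun_eq_iff add.assoc)
      with d(1) have "x - (\<lambda>i. \<alpha> * b i) \<in> bitvec.span B"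
        by (simp only:)
      then show "x \<in> {x. \<exists>\<alpha>. x - (\<lambda>i. \<alpha> * b i) \<in> bitvec.span B}"
        by blast
    qed
    then show ?thesis
      using realizable_add_word[OF assms(1) _ sub bitvec.subspace_span _ False] insert by simp
  qed
qed

lemma realizable_linear_code:
  fixes E :: "nat set"
  assumes "finite E" "linear_code E C"
  shows "realizable E C"
proof -
  have C: "C \<subseteq> words E" "bitvec.span C = C"
    using assms(2) bitvec.span_eq_iff by (auto simp: linear_code_def)
  then have "finite C"
    using finite_subset finite_words[OF assms(1)] by blast
  then show ?thesis
    using realizable_span[OF assms(1) _ C(1)] unfolding C(2) by blast
qed

section \<open>Prescribing weights by subdivision\<close>

text \<open>The weight that a chain would have if each triangle \<open>t\<close> were repeated \<open>\<omega> t\<close> times.\<close>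
definition load :: "('v set \<Rightarrow> nat) \<Rightarrow> 'v set set \<Rightarrow> ('v set \<Rightarrow> bit) \<Rightarrow> nat" where
  "load \<omega> H c = (\<Sum>t\<in>H. if c t = 1 then \<omega> t else 0)"

text \<open>
  The three triangles of the cone carry the value of the old triangle and share its multiplicity
  as \<open>w + 1 + 1\<close>.
\<close>
lemma load_subdivide:
  assumes H: "finite H" "{a, b, c} \<in> H" "p \<notin> \<Union>H" "distinct [p, a, b, c]"
    and w: "\<omega> {a, b, c} = w + 2" and d: "d \<in> cycles H"
  shows "load (\<omega>({p, a, b} := w, {p, a, c} := 1, {p, b, c} := 1)) (subdivide H p a b c)
    (\<lambda>s. d s + d {a, b, c} * tetrahedron p a b c s) = load \<omega> H d"
proof -
  let ?t = "{a, b, c}" and ?\<omega> = "\<omega>({p, a, b} := w, {p, a, c} := 1, {p, b, c} := 1)"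
  let ?d = "\<lambda>s. d s + d {a, b, c} * tetrahedron p a b c s"
  have neq: "{p, a, b} \<noteq> {p, a, c}" "{p, a, b} \<noteq> {p, b, c}" "{p, a, c} \<noteq> {p, b, c}"
    using H(4) by auto
  have new: "{p, a, b} \<notin> H" "{p, a, c} \<notin> H" "{p, b, c} \<notin> H"
    using H(3) by auto
  have disj: "(H - {?t}) \<inter> cone p a b c = {}"
    using new by (auto simp: cone_def)
  have fin: "finite (cone p a b c)"
    by (simp add: cone_def)
  have old: "(if ?d s = 1 then ?\<omega> s else 0) = (if d s = 1 then \<omega> s else 0)" if "s \<in> H - {?t}" for s
  proof -
    have "s \<noteq> {p, a, b}" "s \<noteq> {p, a, c}" "s \<noteq> {p, b, c}"
      using that new by auto
    with that show ?thesis
      by (simp add: tetrahedron_def cone_def)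
  qed
  have "?d s = d ?t" if "s \<in> cone p a b c" for s
  proof -
    have "s \<notin> H"
      using that new by (auto simp: cone_def)
    then have "d s = 0"
      using d by (auto simp: cycles_def words_def)
    with that show ?thesis
      by (simp add: tetrahedron_def)
  qed
  then have "(\<Sum>s\<in>cone p a b c. if ?d s = 1 then ?\<omega> s else 0) =
      (\<Sum>s\<in>cone p a b c. if d ?t = 1 then ?\<omega> s else 0)"
    by (intro sum.cong) simp_all
  also have "\<dots> = (if d ?t = 1 then \<omega> ?t else 0)"
    using neq w by (simp add: cone_def)
  finally have top: "(\<Sum>s\<in>cone p a b c. if ?d s = 1 then ?\<omega> s else 0) =
      (if d ?t = 1 then \<omega> ?t else 0)" .
  have "load ?\<omega> (subdivide H p a b c) ?d =
      (\<Sum>s\<in>H - {?t}. if d s = 1 then \<omega> s else 0) + (if d ?t = 1 then \<omega> ?t else 0)"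
    unfolding load_def subdivide_def sum.union_disjoint[OF finite_Diff[OF H(1)] fin disj] top
    using old by (intro arg_cong2[of _ _ _ _ "(+)"] sum.cong) simp_all
  also have "\<dots> = load \<omega> H d"
    unfolding load_def sum.remove[OF H(1,2)] by simp
  finally show ?thesis .
qed

lemma load_one:
  assumes "finite H" "c \<in> cycles H" "\<forall>t\<in>H. \<omega> t = 1"
  shows "load \<omega> H c = weight c"
proof -
  have "load \<omega> H c = (\<Sum>t\<in>H. if c t = 1 then 1 else 0)"
    unfolding load_def using assms(3) by (intro sum.cong) simp_all
  also have "\<dots> = card {t \<in> H. c t = 1}"
    using assms(1) by (simp add: sum.inter_filter[symmetric])
  also have "{t \<in> H. c t = 1} = {t. c t \<noteq> 0}"
    using assms(2) by (auto simp: cycles_def words_def)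
  finally show ?thesis
    by (simp add: weight_def)
qed

text \<open>
  Subdividing a triangle of multiplicity \<open>w + 2\<close> leaves multiplicities \<open>w\<close>, \<open>1\<close> and \<open>1\<close>, all of them
  odd again, until every multiplicity is \<open>1\<close> and the load is the weight. The sum of the
  multiplicities stays the same, but the sum of the excesses \<open>\<omega> t - 1\<close> decreases.
\<close>
lemma weight_enumerator_of_odd_loads:
  fixes H :: "nat set set" and \<omega> :: "nat set \<Rightarrow> nat"
  assumes "triple_system H" "\<forall>t\<in>H. odd (\<omega> t)"
  shows "\<exists>H' :: nat set set. triple_system H' \<and>
    weight_enumerator (cycles H') = (\<Sum>c\<in>cycles H. monom 1 (load \<omega> H c))"
  using assms
proof (induction "\<Sum>t\<in>H. \<omega> t - 1" arbitrary: H \<omega> rule: less_induct)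
  case less
  have fin: "finite H"
    using less.prems(1) by (rule triple_system_finite)
  show ?case
  proof (cases "\<forall>t\<in>H. \<omega> t = 1")
    case True
    then have "weight_enumerator (cycles H) = (\<Sum>c\<in>cycles H. monom 1 (load \<omega> H c))"
      unfolding weight_enumerator_def using load_one[OF fin] by (intro sum.cong) simp_all
    with less.prems(1) show ?thesis
      by blast
  next
    case False
    then obtain t where t: "t \<in> H" "\<omega> t \<noteq> 1"
      by blast
    then obtain a b c where abc: "t = {a, b, c}" "distinct [a, b, c]"
      using less.prems(1) by (auto simp: triple_system_def card_3_iff)
    obtain p where p: "p \<notin> \<Union>H"
      using ex_new_if_finite[OF infinite_UNIV_nat finite_vertices[OF less.prems(1)]] by blast
    have apex: "distinct [p, a, b, c]"
      using p t(1) abc by auto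
    define w where "w = \<omega> t - 2"
    have "odd (\<omega> t)"
      using less.prems(2) t(1) by blast
    then have w: "\<omega> t = w + 2" "odd w"
      using t(2) unfolding w_def by presburger+
    let ?H = "subdivide H p a b c"
    let ?\<omega> = "\<omega>({p, a, b} := w, {p, a, c} := 1, {p, b, c} := 1)"
    have neq: "{p, a, b} \<noteq> {p, a, c}" "{p, a, b} \<noteq> {p, b, c}" "{p, a, c} \<noteq> {p, b, c}"
      using apex by auto
    have new: "{p, a, b} \<notin> H" "{p, a, c} \<notin> H" "{p, b, c} \<notin> H"
      using p by auto
    have old: "?\<omega> s = \<omega> s" if "s \<in> H" for s
    proof -
      have "s \<noteq> {p, a, b}" "s \<noteq> {p, a, c}" "s \<noteq> {p, b, c}"
        using that new by auto
      then show ?thesis by simp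
    qed
    have "(\<Sum>s\<in>?H. ?\<omega> s - 1) = (\<Sum>s\<in>H - {t}. ?\<omega> s - 1) + (\<Sum>s\<in>cone p a b c. ?\<omega> s - 1)"
      unfolding subdivide_def abc(1) using fin new
      by (intro sum.union_disjoint) (auto simp: cone_def)
    also have "(\<Sum>s\<in>cone p a b c. ?\<omega> s - 1) = w - 1"
      using neq by (simp add: cone_def)
    also have "(\<Sum>s\<in>H - {t}. ?\<omega> s - 1) = (\<Sum>s\<in>H - {t}. \<omega> s - 1)"
      using old by (intro sum.cong) simp_all
    also have "(\<Sum>s\<in>H - {t}. \<omega> s - 1) + (w - 1) < (\<Sum>s\<in>H. \<omega> s - 1)"
      unfolding sum.remove[OF fin t(1)] using w by simp
    finally have "(\<Sum>s\<in>?H. ?\<omega> s - 1) < (\<Sum>s\<in>H. \<omega> s - 1)" .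
    moreover have "\<forall>s\<in>?H. odd (?\<omega> s)"
      using less.prems(2) w(2) by (auto simp: subdivide_def cone_def)
    ultimately obtain H' :: "nat set set" where H': "triple_system H'"
      "weight_enumerator (cycles H') = (\<Sum>c\<in>cycles ?H. monom 1 (load ?\<omega> ?H c))"
      using less.hyps triple_system_subdivide[OF less.prems(1) apex] by blast
    have "\<not> adjacent H p a" "\<not> adjacent H p b \<or> {p, b, c} \<in> H"
      using p by (auto simp: adjacent_def)
    then have bij: "bij_betw (\<lambda>d s. d s + d {a, b, c} * tetrahedron p a b c s) (cycles H) (cycles ?H)"
      using t(1) unfolding abc(1) by (intro cycles_subdivide[OF fin _ apex])
    have "(\<Sum>c\<in>cycles ?H. monom 1 (load ?\<omega> ?H c)) =
      (\<Sum>d\<in>cycles H. monom (1 :: int) (load ?\<omega> ?H (\<lambda>s. d s + d {a, b, c} * tetrahedron p a b c s)))"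
      by (rule sum.reindex_bij_betw[OF bij, symmetric])
    also have "\<dots> = (\<Sum>d\<in>cycles H. monom 1 (load \<omega> H d))"
      using load_subdivide[OF fin _ p apex] t(1) abc(1) w(1) by (intro sum.cong) auto
    finally show ?thesis
      using H' by auto
  qed
qed

section \<open>Reducing the exponents\<close>

text \<open>
  The coefficients \<open>a i\<close> are determined by the polynomial: \<open>a i\<close> is the number of elements of \<open>Z\<close>
  with exponent \<open>i\<close>, and no exponent exceeds \<open>m\<close>. So exponents can be reduced term by term.
\<close>
lemma reduce_exponents:
  fixes f :: "'c \<Rightarrow> nat" and a :: "nat \<Rightarrow> int"
  assumes "finite Z" and eq: "(\<Sum>c\<in>Z. monom 1 (f c)) = (\<Sum>i=0..m. monom (a i) i)"
  shows "(\<Sum>i=0..m. monom (a i) (i mod e)) = (\<Sum>c\<in>Z. monom 1 (f c mod e))"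
proof -
  have co: "(if i \<le> m then a i else 0) = int (card {c \<in> Z. f c = i})" for i
  proof -
    have "coeff (\<Sum>i=0..m. monom (a i) i) i = (if i \<le> m then a i else 0)"
      by (simp add: coeff_sum)
    moreover have "coeff (\<Sum>c\<in>Z. monom (1 :: int) (f c)) i = int (card {c \<in> Z. f c = i})"
      using assms(1) by (simp add: coeff_sum sum.inter_filter[symmetric])
    ultimately show ?thesis
      using eq by simp
  qed
  have le: "f c \<le> m" if "c \<in> Z" for c
  proof (rule ccontr)
    assume "\<not> f c \<le> m"
    then have "card {c' \<in> Z. f c' = f c} = 0"
      using co[of "f c"] by simp
    with that assms(1) show False
      by auto
  qed
  have "(\<Sum>i=0..m. monom (a i) (i mod e)) = (\<Sum>i=0..m. \<Sum>c\<in>{c \<in> Z. f c = i}. monom 1 (f c mod e))"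
  proof (intro sum.cong refl)
    fix i assume "i \<in> {0..m}"
    then have "a i = int (card {c \<in> Z. f c = i})"
      using co[of i] by simp
    then show "monom (a i) (i mod e) = (\<Sum>c\<in>{c \<in> Z. f c = i}. monom 1 (f c mod e))"
      by (simp add: of_nat_poly smult_monom)
  qed
  also have "\<dots> = (\<Sum>c\<in>Z. monom 1 (f c mod e))"
    using assms(1) le by (intro sum.group) auto
  finally show ?thesis .
qed

text \<open>
  Multiplicity \<open>e\<close> counts for nothing modulo \<open>e\<close>, so only the extra \<open>2\<close> on each marked triangle
  remains, and \<open>e > 2 * n\<close> makes the residue exact.
\<close>
lemma load_mod:
  assumes "triple_system H" "inj_on \<tau> {..<n}" "\<tau> ` {..<n} \<subseteq> H" and e: "e = 2 * n + 1"
  shows "load (\<lambda>t. if t \<in> \<tau> ` {..<n} then e + 2 else e) H c mod e = 2 * weight (readout \<tau> {..<n} c)"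
proof -
  have fin: "finite H"
    using assms(1) by (rule triple_system_finite)
  let ?S = "{i \<in> {..<n}. c (\<tau> i) = 1}"
  have "{i. readout \<tau> {..<n} c i \<noteq> 0} = ?S"
    by (auto simp: readout_def)
  then have w: "weight (readout \<tau> {..<n} c) = card ?S"
    by (simp add: weight_def)
  have "load (\<lambda>t. if t \<in> \<tau> ` {..<n} then e + 2 else e) H c =
      (\<Sum>t\<in>H. (if c t = 1 then e else 0) + (if t \<in> \<tau> ` ?S then 2 else 0))"
    unfolding load_def by (intro sum.cong) auto
  also have "\<dots> = e * card {t \<in> H. c t = 1} + 2 * card {t \<in> H. t \<in> \<tau> ` ?S}"
    using fin by (simp add: sum.distrib sum.inter_filter[symmetric])
  also have "{t \<in> H. t \<in> \<tau> ` ?S} = \<tau> ` ?S"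
    using assms(3) by blast
  also have "card (\<tau> ` ?S) = card ?S"
    using assms(2) by (intro card_image) (auto intro: inj_on_subset)
  finally have "load (\<lambda>t. if t \<in> \<tau> ` {..<n} then e + 2 else e) H c mod e = (2 * card ?S) mod e"
    by simp
  moreover have "card ?S \<le> n"
    using card_mono[of "{..<n}" ?S] by auto
  then have "2 * card ?S < e"
    using e by linarith
  ultimately show ?thesis
    using w by simp
qed

lemma pcompose_weight_enumerator_square:
  "pcompose (weight_enumerator C) (monom 1 2) = (\<Sum>c\<in>C. monom 1 (2 * weight c))"
proof -
  have "pcompose (monom (1 :: int) k) (monom 1 2) = monom 1 (2 * k)" for k
    by (induction k) (simp_all add: monom_Suc monom_0 pcompose_pCons mult_monom one_pCons)
  then show ?thesis
    by (simp add: weight_enumerator_def pcompose_sum)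
qed

theorem theorem1:
  "\<exists>K::nat. \<forall>n\<ge>1. \<forall>C. linear_code {..<n::nat} C \<longrightarrow>
     (\<exists>(\<Delta> :: nat set set) (e :: nat).
        triangular_configuration \<Delta> \<and> 0 < e \<and> e \<le> K * n \<and>
        (\<forall>(m :: nat) (a :: nat \<Rightarrow> int).
           weight_enumerator (cycle_space \<Delta>) = (\<Sum>i=0..m. monom (a i) i) \<longrightarrow>
           pcompose (weight_enumerator C) (monom 1 2) = (\<Sum>i=0..m. monom (a i) (i mod e))))"
proof (intro exI[of _ 3] allI impI)
  fix n :: nat and C
  assume "1 \<le> n" and C: "linear_code {..<n} C"
  obtain H :: "nat set set" and \<tau> where H: "triple_system H" "inj_on \<tau> {..<n}" "\<tau> ` {..<n} \<subseteq> H"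
    and bij: "bij_betw (readout \<tau> {..<n}) (cycles H) C"
    using realizable_linear_code[OF _ C] by (auto simp: realizable_def realizes_def)
  define e where "e = 2 * n + 1"
  define \<omega> where "\<omega> = (\<lambda>t. if t \<in> \<tau> ` {..<n} then e + 2 else e)"
  have "\<forall>t\<in>H. odd (\<omega> t)"
    by (simp add: \<omega>_def e_def)
  then obtain G :: "nat set set" where G: "triple_system G"
    "weight_enumerator (cycles G) = (\<Sum>c\<in>cycles H. monom 1 (load \<omega> H c))"
    using weight_enumerator_of_odd_loads[OF H(1)] by blast
  have "finite (cycles H)"
    using finite_words[OF triple_system_finite[OF H(1)]] by (auto simp: cycles_def)
  have "pcompose (weight_enumerator C) (monom 1 2) = (\<Sum>i=0..m. monom (a i) (i mod e))"
    if "weight_enumerator (cycle_space (complex_of G)) = (\<Sum>i=0..m. monom (a i) i)" for m a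
  proof -
    have "(\<Sum>i=0..m. monom (a i) (i mod e)) = (\<Sum>c\<in>cycles H. monom 1 (load \<omega> H c mod e))"
      using that unfolding cycle_space_complex_of[OF G(1)] G(2)
      by (intro reduce_exponents \<open>finite (cycles H)\<close>)
    also have "\<dots> = (\<Sum>c\<in>cycles H. monom 1 (2 * weight (readout \<tau> {..<n} c)))"
      unfolding \<omega>_def load_mod[OF H e_def] ..
    also have "\<dots> = (\<Sum>c\<in>C. monom 1 (2 * weight c))"
      by (rule sum.reindex_bij_betw[OF bij])
    finally show ?thesis
      by (simp add: pcompose_weight_enumerator_square)
  qed
  moreover have "triangular_configuration (complex_of G)"
    using triangular_configuration_complex_of[OF G(1)] .
  moreover have "0 < e" "e \<le> 3 * n"
    using \<open>1 \<le> n\<close> by (auto simp: e_def)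
  ultimately show "\<exists>\<Delta> (e :: nat). triangular_configuration (\<Delta> :: nat set set) \<and> 0 < e \<and> e \<le> 3 * n \<and>
      (\<forall>m (a :: nat \<Rightarrow> int).
        weight_enumerator (cycle_space \<Delta>) = (\<Sum>i=0..m. monom (a i) i) \<longrightarrow>
        pcompose (weight_enumerator C) (monom 1 2) = (\<Sum>i=0..m. monom (a i) (i mod e)))"
    by blast
qed

end
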